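(* Let $p$ be a prime and let $k \geq 2$ be an integer such that $p \geq k$. Then $$|\operatorname{Pgr}(\mathbb{Z}/p^k)| = p!\,\bigl[(p-1)\,p^{(k^2+k-4)/2}\bigr]^p.$$
   Context: For an associative ring $R$ with identity, a polynomial $f\in R[x]$ is called a permutation polynomial if the induced evaluation function $R\to R$ is bijective. The polypermutation group $\operatorname{Pgr}(R)$ is the subgroup of the symmetric group of the set $R$ generated by all permutations of $R$ that are induced by polynomials in $R[x]$. *)

theory Defs
  imports "HOL-Algebra.Polynomial_Divisibility" "HOL-Algebra.Generated_Groups" "HOL-Algebra.Bij" "HOL-Number_Theory.Residues"
begin

hide_const (open) Divisibility.prime

text \<open>The function induced by a polynomial is restricted to the carrier, since the
  elements of \<^const>\<open>BijGroup\<close> are extensional.\<close>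

definition poly_fun :: "('a, 'b) ring_scheme \<Rightarrow> 'a list \<Rightarrow> 'a \<Rightarrow> 'a"
  where "poly_fun R f = restrict (ring.eval R f) (carrier R)"

definition permutation_polynomial :: "('a, 'b) ring_scheme \<Rightarrow> 'a list \<Rightarrow> bool"
  where "permutation_polynomial R f \<longleftrightarrow>
    f \<in> carrier (poly_ring R) \<and> bij_betw (poly_fun R f) (carrier R) (carrier R)"

text \<open>Evaluation puts coefficients to the left of the powers of the argument, which fixes
  the convention when \<open>R\<close> is not commutative.\<close>

definition Pgr :: "('a, 'b) ring_scheme \<Rightarrow> ('a \<Rightarrow> 'a) monoid"
  where "Pgr R =
    subgroup_generated (BijGroup (carrier R)) {poly_fun R f |f. permutation_polynomial R f}"

end

theory Submission
  imports Defs "HOL-Combinatorics.Permutations" "HOL-Computational_Algebra.Polynomial"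
begin

text \<open>The bijective polynomial functions are closed under composition, hence already form a
  group. Modulo \<open>p\<^sup>k\<close> the polynomial \<open>1 - x\<^sup>n\<close> with \<open>n = \<phi>(p\<^sup>k) \<ge> k\<close> is the indicator of the
  residue class of \<open>0\<close> modulo \<open>p\<close>, so a polynomial function can be prescribed independently on
  each of the \<open>p\<close> residue classes. On the class of \<open>a\<close> it has the form
  \<open>\<Sum>j<k. c\<^sub>j (x - a)\<^sup>j\<close>, where \<open>c\<^sub>j\<close> matters exactly modulo \<open>p\<^bsup>k - j\<^esup>\<close>: since \<open>k \<le> p\<close>, a polynomial
  of degree less than \<open>k\<close> that vanishes modulo \<open>p\<^sup>k\<close> at \<open>k\<close> points distinct modulo \<open>p\<close> has all
  coefficients divisible by \<open>p\<^sup>k\<close>. The function is bijective iff \<open>a \<mapsto> c\<^sub>0\<close> permutes the residues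
  modulo \<open>p\<close> and no \<open>c\<^sub>1\<close> is divisible by \<open>p\<close>; counting these data gives the formula.\<close>

hide_const (open) Polynomial.order

section \<open>Polynomial functions modulo \<open>m\<close> and the carrier of
  \<open>Pgr\<close>\<close>

definition residue_fun :: "int \<Rightarrow> int poly \<Rightarrow> int \<Rightarrow> int"
  where "residue_fun m f = (\<lambda>x\<in>{0..m - 1}. poly f x mod m)"

lemma cong_poly:
  fixes f :: "int poly"
  assumes "[x = y] (mod m)"
  shows "[poly f x = poly f y] (mod m)"
  by (induction f) (auto intro!: cong_add cong_mult assms)

text \<open>In a finite group the inverse of \<open>x\<close> is the power of \<open>x\<close> with
  exponent \<open>order G - 1\<close>, so closure under products already gives closure under
  inverses.\<close>

lemma (in group) subgroup_finiteI:
  assumes "finite (carrier G)" "H \<subseteq> carrier G" "\<one> \<in> H"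
    and closed: "\<And>x y. x \<in> H \<Longrightarrow> y \<in> H \<Longrightarrow> x \<otimes> y \<in> H"
  shows "subgroup H G"
proof
  fix x assume x: "x \<in> H"
  then have xG: "x \<in> carrier G"
    using assms(2) by blast
  have pow: "x [^] n \<in> H" for n :: nat
    by (induction n) (use x assms(3) closed in auto)
  have "order G = Suc (order G - 1)"
    using order_gt_0_iff_finite assms(1) by simp
  then have "x [^] (order G - 1) \<otimes> x = \<one>"
    by (metis nat_pow_Suc pow_order_eq_1 xG)
  then have "inv x = x [^] (order G - 1)"
    using xG by (simp add: inv_equality)
  then show "inv x \<in> H"
    using pow by simp
qed (use assms in auto)

lemma finite_Bij: "finite S \<Longrightarrow> finite (Bij S)"
  by (rule finite_subset[OF _ finite_PiE[of S "\<lambda>_. S"]])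
     (auto simp: Bij_def PiE_def dest: bij_betw_imp_funcset)

context residues
begin

text \<open>The reversal appears because \<open>eval\<close> reads coefficient lists from the
  leading coefficient down, while \<open>Poly\<close> starts at the constant term.\<close>

lemma eval_residue_ring:
  assumes "set l \<subseteq> carrier R" "x \<in> carrier R"
  shows "eval l x = poly (Poly (rev l)) x mod m"
  using assms(1)
proof (induction l)
  case Nil
  then show ?case by (simp add: res_zero_eq)
next
  case (Cons a l)
  have "x mod m = x"
    using assms(2) by (auto simp: res_carrier_eq)
  then have "x [^] length l = x ^ length l mod m"
    using pow_cong[of x "length l"] by simp
  moreover have "[a * (x ^ length l mod m) mod m + poly (Poly (rev l)) x mod m
      = a * x ^ length l + poly (Poly (rev l)) x] (mod m)"
    by (intro cong_add) (simp_all add: cong_def mod_simps)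
  ultimately show ?case
    using Cons by (simp add: Poly_snoc poly_monom res_add_eq res_mult_eq cong_def add.commute)
qed

lemma poly_fun_residue_ring:
  assumes "l \<in> carrier (poly_ring R)"
  shows "poly_fun R l = residue_fun m (Poly (rev l))"
  using assms eval_residue_ring
  by (auto simp: poly_fun_def residue_fun_def res_carrier_eq univ_poly_carrier[symmetric]
      polynomial_def res_zero_eq fun_eq_iff restrict_def)

lemma residue_fun_eq_poly_fun:
  "\<exists>l \<in> carrier (poly_ring R). residue_fun m f = poly_fun R l"
proof -
  define l0 where "l0 = map (\<lambda>c. c mod m) (rev (coeffs f))"
  have l0: "set l0 \<subseteq> carrier R"
    using m_gt_one by (auto simp: l0_def res_carrier_eq)
  \<comment> \<open>Reduction modulo \<open>m\<close> may kill leading coefficients;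
    \<open>normalize\<close> strips the zeros so that the list is a genuine element of
    \<open>poly_ring R\<close>.\<close>
  have mem: "normalize l0 \<in> carrier (poly_ring R)"
    using normalize_gives_polynomial[OF l0] by (simp add: univ_poly_carrier)
  have cong: "[poly (Poly (map (\<lambda>c. c mod m) cs)) x = poly (Poly cs) x] (mod m)" for cs x
    by (induction cs) (auto intro!: cong_add cong_mult)
  have "poly_fun R (normalize l0) = residue_fun m f"
  proof -
    have "eval (normalize l0) x = poly f x mod m" if "x \<in> carrier R" for x
      using eval_normalize[OF l0 that] eval_residue_ring[OF l0 that] cong[of "coeffs f" x]
      by (simp add: l0_def rev_map cong_def)
    then show ?thesis
      by (auto simp: poly_fun_def residue_fun_def res_carrier_eq fun_eq_iff restrict_def)
  qed
  with mem show ?thesis by metis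
qed

lemma carrier_Pgr_residue_ring:
  "carrier (Pgr R) = Bij {0..m - 1} \<inter> range (residue_fun m)"
proof -
  let ?S = "{0..m - 1}" and ?A = "Bij {0..m - 1} \<inter> range (residue_fun m)"
  interpret B: group "BijGroup ?S" by (rule group_BijGroup)
  have gens: "{poly_fun R f |f. permutation_polynomial R f} = ?A" (is "?G = _")
  proof
    show "?G \<subseteq> ?A"
      by (auto simp: permutation_polynomial_def poly_fun_residue_ring Bij_def res_carrier_eq)
         (auto simp: residue_fun_def)
    show "?A \<subseteq> ?G"
      using residue_fun_eq_poly_fun
      by (fastforce simp: permutation_polynomial_def Bij_def res_carrier_eq)
  qed
  have "subgroup ?A (BijGroup ?S)"
  proof (rule B.subgroup_finiteI)
    show "finite (carrier (BijGroup ?S))"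
      by (simp add: BijGroup_def finite_Bij)
    show "?A \<subseteq> carrier (BijGroup ?S)"
      by (auto simp: BijGroup_def)
    have "(\<lambda>x\<in>?S. x) = residue_fun m [:0, 1:]"
      by (auto simp: residue_fun_def fun_eq_iff restrict_def)
    then show "\<one>\<^bsub>BijGroup ?S\<^esub> \<in> ?A"
      using id_Bij[of ?S] by (auto simp: BijGroup_def)
    fix x y assume xy: "x \<in> ?A" "y \<in> ?A"
    then obtain f g where f: "x = residue_fun m f" and g: "y = residue_fun m g"
      by blast
    have "compose ?S x y = residue_fun m (f \<circ>\<^sub>p g)"
    proof
      fix t
      have "poly f (poly g t mod m) mod m = poly f (poly g t) mod m"
        using cong_poly[of "poly g t mod m" "poly g t" m f] by (simp add: cong_def)
      then show "compose ?S x y t = residue_fun m (f \<circ>\<^sub>p g) t"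
        using m_gt_one by (auto simp: f g compose_def residue_fun_def poly_pcompose)
    qed
    with xy show "x \<otimes>\<^bsub>BijGroup ?S\<^esub> y \<in> ?A"
      using compose_Bij[of x ?S y] by (auto simp: BijGroup_def)
  qed
  then have "generate (BijGroup ?S) ?A = ?A"
    by (rule B.generateI[symmetric, OF _ subset_refl]) (auto intro: generate.incl)
  then show ?thesis
    by (simp add: Pgr_def gens carrier_subgroup_generated res_carrier_eq BijGroup_def
        Int_assoc[symmetric])
qed

end

section \<open>Integer polynomials with values divisible by a prime power\<close>

text \<open>This is the bound on the number of roots, modulo \<open>m\<close>. After splitting off
  \<open>x - c\<close>, the factor \<open>s - c\<close> is a unit modulo \<open>m\<close> at every
  other point \<open>s\<close>, so the quotient inherits the divisibility there and has smaller
  degree.\<close>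

lemma const_dvd_of_values_dvd:
  fixes g :: "int poly"
  assumes "finite S" "\<And>s. s \<in> S \<Longrightarrow> m dvd poly g s"
    and "\<And>s t. s \<in> S \<Longrightarrow> t \<in> S \<Longrightarrow> s \<noteq> t \<Longrightarrow> coprime (s - t) m"
    and "degree g < card S"
  shows "[:m:] dvd g"
  using assms
proof (induction S arbitrary: g rule: finite_induct)
  case empty
  then show ?case by simp
next
  case (insert c S)
  define h where "h = synthetic_div g c"
  have g: "[:- c, 1:] * h + [:poly g c:] = g"
    unfolding h_def by (rule synthetic_div_correct')
  have "[:m:] dvd h"
  \<comment> \<open>Without remaining points the degree bound of the induction hypothesis cannot
    hold; there \<open>g\<close> is constant and the quotient is zero.\<close>
  proof (cases "S = {}")
    case True
    then have "h = 0"
      using insert.prems(3) by (simp add: h_def synthetic_div_eq_0_iff)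
    then show ?thesis by simp
  next
    case False
    show ?thesis
    proof (rule insert.IH)
      fix s assume s: "s \<in> S"
      have "poly g s = (s - c) * poly h s + poly g c"
        by (subst g[symmetric]) (simp add: algebra_simps)
      then have "m dvd (s - c) * poly h s"
        using insert.prems(1)[of s] insert.prems(1)[of c] s by (simp add: dvd_add_left_iff)
      moreover have "coprime (s - c) m"
        using insert.prems(2) insert.hyps s by auto
      ultimately show "m dvd poly h s"
        by (simp add: coprime_dvd_mult_right_iff coprime_commute)
    next
      have "card S > 0"
        using False insert.hyps by (simp add: card_gt_0_iff)
      then show "degree h < card S"
        using insert.prems(3) insert.hyps by (simp add: h_def degree_synthetic_div)
    qed (use insert.prems in auto)
  qed
  then have "[:m:] dvd [:- c, 1:] * h"
    by (rule dvd_mult)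
  moreover have "[:m:] dvd [:poly g c:]"
    using insert.prems(1) by simp
  ultimately show ?case
    using g by (metis dvd_add)
qed

text \<open>The difference quotient of \<open>g\<close> at two multiples of \<open>p\<close> is
  congruent modulo \<open>p\<close> to the derivative at 0, which is
  \<open>coeff g 1\<close>.\<close>

lemma poly_diff_near_0:
  fixes g :: "int poly"
  assumes "p dvd x" "p dvd y"
  shows "\<exists>r. poly g x - poly g y = (x - y) * (coeff g 1 + p * r)"
proof (induction g)
  case 0
  show ?case by (intro exI[of _ 0]) simp
next
  case (pCons a g)
  then obtain r where r: "poly g x - poly g y = (x - y) * (coeff g 1 + p * r)" by blast
  obtain s where s: "poly g x - coeff g 0 = p * s"
  proof -
    have "[poly g x = poly g 0] (mod p)"
      using assms by (intro cong_poly) (simp add: cong_0_iff)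
    then show ?thesis
      using that by (auto simp: cong_iff_dvd_diff poly_0_coeff_0)
  qed
  obtain y' where y': "y = p * y'" using assms by blast
  have "poly (pCons a g) x - poly (pCons a g) y = (x - y) * poly g x + y * (poly g x - poly g y)"
    by (simp add: algebra_simps)
  also have "\<dots> = (x - y) * (coeff g 0 + (poly g x - coeff g 0) + y * (coeff g 1 + p * r))"
    unfolding r by (simp add: algebra_simps)
  also have "\<dots> = (x - y) * (coeff (pCons a g) 1 + p * (s + y' * (coeff g 1 + p * r)))"
    unfolding s by (simp add: y' algebra_simps)
  finally show ?case by blast
qed

lemma prime_power_dvd_coeff_of_values:
  fixes g :: "int poly" and p :: nat
  assumes "prime p" "n \<le> p" "degree g < n" "\<And>t. t < n \<Longrightarrow> int p ^ e dvd poly g (int t)"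
  shows "int p ^ e dvd coeff g i"
proof -
  have "[:int p ^ e:] dvd g"
  proof (rule const_dvd_of_values_dvd)
    fix s t assume "s \<in> {0..<int n}" "t \<in> {0..<int n}" "s \<noteq> t"
    then have "\<not> int p dvd s - t"
      using \<open>n \<le> p\<close> dvd_imp_le_int[of "s - t" "int p"] by auto
    then show "coprime (s - t) (int p ^ e)"
      using \<open>prime p\<close> prime_imp_coprime[of "int p" "s - t"]
      by (simp add: coprime_commute[of "s - t"])
  next
    fix s assume "s \<in> {0..<int n}"
    then show "int p ^ e dvd poly g s"
      using assms(4)[of "nat s"] by auto
  qed (use assms in auto)
  then show ?thesis
    by (simp add: const_poly_dvd_iff)
qed

lemma nat_eq_of_dvd_diff:
  fixes a b n :: nat
  assumes "int n dvd int a - int b" "a < n" "b < n"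
  shows "a = b"
  using assms by (metis cong_iff_dvd_diff cong_int_iff cong_less_modulus_unique_nat)

section \<open>Local expansions on residue classes modulo \<open>p\<close>\<close>

locale large_prime_power =
  fixes p k :: nat
  assumes prime_p: "prime p" and k_ge_2: "k \<ge> 2" and k_le_p: "k \<le> p"
begin

abbreviation P :: int where "P \<equiv> int p"

lemma p_gt_1: "p > 1"
  using prime_p prime_gt_1_nat by blast

lemma prime_P: "prime P"
  using prime_p by simp

text \<open>Substituting \<open>P * X\<close> for the variable multiplies coefficient
  \<open>i\<close> by \<open>P ^ i\<close>. The new polynomial vanishes modulo \<open>P ^ k\<close>
  at \<open>k\<close> points that are distinct modulo \<open>p\<close> because
  \<open>k \<le> p\<close>, so its coefficients vanish too, and cancelling \<open>P ^ i\<close>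
  leaves the modulus \<open>P ^ (k - i)\<close>.\<close>

lemma local_poly_coeff_cong:
  assumes "degree G < k" "degree H < k" "i < k"
    and "\<And>t. t < k \<Longrightarrow> P ^ k dvd poly G (P * int t) - poly H (P * int t)"
  shows "P ^ (k - i) dvd coeff G i - coeff H i"
proof -
  let ?D = "pcompose (G - H) [:0, P:]"
  have "degree (G - H) < k"
    using assms by (intro degree_diff_less)
  then have "degree ?D < k"
    using degree_pcompose_le[of "G - H" "[:0, P:]"] by (simp split: if_splits)
  then have "P ^ k dvd coeff ?D i"
    using assms prime_p k_le_p
    by (intro prime_power_dvd_coeff_of_values[of p k]) (auto simp: poly_pcompose mult.commute)
  then have "P ^ i * P ^ (k - i) dvd P ^ i * (coeff G i - coeff H i)"
    using \<open>i < k\<close> by (simp add: coeff_pcompose_linear flip: power_add)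
  then show ?thesis
    using p_gt_1 by simp
qed

text \<open>Here \<open>x ^ i\<close> supplies the missing factor \<open>P ^ i\<close>, and for
  \<open>i \<ge> k\<close> it vanishes modulo \<open>P ^ k\<close> by itself. Hence no degree bound
  is imposed, and polynomials of any degree can be compared.\<close>

lemma local_poly_value_cong:
  assumes "\<And>i. i < k \<Longrightarrow> P ^ (k - i) dvd coeff G i - coeff H i" and "P dvd x"
  shows "P ^ k dvd poly G x - poly H x"
proof -
  have "P ^ k dvd coeff (G - H) i * x ^ i" for i
  proof (cases "i < k")
    case True
    then have "P ^ (k - i) * P ^ i dvd coeff (G - H) i * x ^ i"
      using assms by (intro mult_dvd_mono) (auto intro: dvd_power_same)
    then show ?thesis
      using True by (simp flip: power_add)
  next
    case False
    then have "P ^ k dvd x ^ i"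
      using assms(2) by (meson dvd_power_same dvd_trans le_imp_power_dvd not_less)
    then show ?thesis by simp
  qed
  then have "P ^ k dvd poly (G - H) x"
    unfolding poly_altdef by (intro dvd_sum) auto
  then show ?thesis by simp
qed

lemma indicator_poly:
  "\<exists>e :: int poly. \<forall>x. [poly e x = (if P dvd x then 1 else 0)] (mod P ^ k)"
proof (intro exI allI)
  let ?n = "totient (p ^ k)"
  fix x
  \<comment> \<open>This makes \<open>x ^ ?n\<close> vanish modulo \<open>P ^ k\<close> whenever
    \<open>P dvd x\<close>; for the other \<open>x\<close> Euler's theorem gives 1.\<close>
  have n: "k \<le> ?n"
  proof -
    have "k \<le> 2 ^ (k - 1)"
      using k_ge_2 less_exp[of "k - 1"] by linarith
    also have "\<dots> \<le> p ^ (k - 1)"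
      using p_gt_1 by (intro power_mono) auto
    also have "\<dots> \<le> p ^ (k - 1) * (p - 1)"
      using p_gt_1 by simp
    finally show ?thesis
      using prime_p k_ge_2 by (simp add: totient_prime_power)
  qed
  show "[poly (1 - monom 1 ?n) x = (if P dvd x then 1 else 0)] (mod P ^ k)"
  proof (cases "P dvd x")
    case True
    then have "P ^ k dvd x ^ ?n"
      using n by (meson dvd_power_same dvd_trans le_imp_power_dvd)
    with True show ?thesis
      by (simp add: poly_monom cong_iff_dvd_diff)
  next
    case False
    then have "coprime x (int (p ^ k))"
      using prime_imp_coprime[OF prime_P, of x] by (simp add: coprime_commute[of x])
    moreover interpret residues "int (p ^ k)" "residue_ring (int (p ^ k))"
      using p_gt_1 k_ge_2 by unfold_locales (auto intro: one_less_power)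
    have "[x ^ ?n = 1] (mod P ^ k)" if "coprime x (int (p ^ k))"
      using euler_theorem[OF that] by (simp flip: of_nat_power)
    ultimately show ?thesis
      using False by (simp add: poly_monom cong_iff_dvd_diff dvd_diff_commute)
  qed
qed

lemma glue_local_polys:
  fixes g :: "int \<Rightarrow> int poly"
  shows "\<exists>f. \<forall>x. [poly f x = poly (g (x mod P)) (x - x mod P)] (mod P ^ k)"
proof -
  obtain e :: "int poly" where e: "\<And>x. [poly e x = (if P dvd x then 1 else 0)] (mod P ^ k)"
    using indicator_poly by blast
  let ?f = "\<Sum>a\<in>{0..<P}. pcompose (e * g a) [:- a, 1:]"
  have "[poly ?f x = poly (g (x mod P)) (x - x mod P)] (mod P ^ k)" for x
  proof -
    have "poly ?f x = (\<Sum>a\<in>{0..<P}. poly e (x - a) * poly (g a) (x - a))"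
      by (simp add: poly_sum poly_pcompose)
    also have "[\<dots> = (\<Sum>a\<in>{0..<P}. (if P dvd x - a then 1 else 0) * poly (g a) (x - a))]
        (mod P ^ k)"
      by (intro cong_sum cong_mult e cong_refl)
    also have "(\<Sum>a\<in>{0..<P}. (if P dvd x - a then 1 else 0) * poly (g a) (x - a))
        = (\<Sum>a\<in>{0..<P}. if a = x mod P then poly (g a) (x - a) else 0)"
      by (intro sum.cong) (auto simp: mod_eq_dvd_iff[symmetric])
    also have "\<dots> = poly (g (x mod P)) (x - x mod P)"
      using p_gt_1 by simp
    finally show ?thesis .
  qed
  then show ?thesis by blast
qed

text \<open>Modulo \<open>P\<close> the value of \<open>F\<close> depends only on the constant
  coefficient of the class, which separates classes. Inside one class
  \<open>poly_diff_near_0\<close> writes differences of values as \<open>x - y\<close> times a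
  factor congruent to the linear coefficient, a unit exactly when \<open>P\<close> does not divide
  that coefficient.\<close>

lemma inj_on_residues_iff_local:
  fixes F :: "int \<Rightarrow> int" and g :: "int \<Rightarrow> int poly"
  assumes F: "\<And>x. [F x = poly (g (x mod P)) (x - x mod P)] (mod P ^ k)"
  shows "inj_on (\<lambda>x. F x mod P ^ k) {0..P ^ k - 1} \<longleftrightarrow>
    inj_on (\<lambda>a. coeff (g a) 0 mod P) {0..P - 1} \<and> (\<forall>a\<in>{0..P - 1}. \<not> P dvd coeff (g a) 1)"
    (is "?L \<longleftrightarrow> ?R0 \<and> ?R1")
proof -
  have Pk: "P dvd P ^ k"
    using k_ge_2 by simp
  have mod_P: "F x mod P = coeff (g (x mod P)) 0 mod P" for x
  proof -
    have "[F x = poly (g (x mod P)) (x - x mod P)] (mod P)"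
      using F Pk by (rule cong_dvd_modulus)
    also have "[poly (g (x mod P)) (x - x mod P) = poly (g (x mod P)) 0] (mod P)"
      by (intro cong_poly) (simp add: cong_def mod_simps)
    finally show ?thesis
      by (simp add: cong_def poly_0_coeff_0)
  qed
  have P_less: "P < P ^ k"
    using p_gt_1 k_ge_2 power_strict_increasing[of 1 k P] by simp
  show ?thesis
  proof
    assume L: ?L
    have R0: ?R0
    proof (rule finite_surj_inj)
      \<comment> \<open>An injective self-map of the residues modulo \<open>P ^ k\<close> hits every
        residue, so its reduction modulo \<open>P\<close> is onto.\<close>
      show "{0..P - 1} \<subseteq> (\<lambda>a. coeff (g a) 0 mod P) ` {0..P - 1}"
      proof
        fix r assume r: "r \<in> {0..P - 1}"
        have "(\<lambda>x. F x mod P ^ k) ` {0..P ^ k - 1} = {0..P ^ k - 1}"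
          using L p_gt_1 by (intro endo_inj_surj) auto
        moreover have "r \<in> {0..P ^ k - 1}"
          using P_less r unfolding atLeastAtMost_iff by linarith
        ultimately have "r \<in> (\<lambda>x. F x mod P ^ k) ` {0..P ^ k - 1}"
          by (simp only:)
        then obtain x where x: "r = F x mod P ^ k"
          by blast
        have "r = r mod P"
          using r by simp
        also have "\<dots> = F x mod P"
          unfolding x using Pk by (simp add: mod_mod_cancel)
        finally have "r = coeff (g (x mod P)) 0 mod P"
          by (simp add: mod_P)
        moreover have "x mod P \<in> {0..P - 1}"
          using p_gt_1 by simp
        ultimately show "r \<in> (\<lambda>a. coeff (g a) 0 mod P) ` {0..P - 1}"
          by blast
      qed
    qed simp
    have R1: ?R1
    proof (intro ballI notI)
      fix a assume a: "a \<in> {0..P - 1}" and dvd: "P dvd coeff (g a) 1"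
      \<comment> \<open>If \<open>P\<close> divides the linear coefficient, a step of size
        \<open>P ^ (k - 1)\<close> changes the value by a multiple of \<open>P ^ k\<close>, so
        \<open>a\<close> and \<open>a + h\<close> collide.\<close>
      define h where "h = P ^ (k - 1)"
      have h: "P dvd h" "h * P = P ^ k" "h > 0"
        using k_ge_2 p_gt_1 by (auto simp: h_def power_Suc2[symmetric] simp del: power_Suc)
      obtain r where r: "poly (g a) h - poly (g a) 0 = (h - 0) * (coeff (g a) 1 + P * r)"
        using poly_diff_near_0[OF h(1) dvd_0_right] by blast
      have "h * P dvd poly (g a) h - poly (g a) 0"
        unfolding r using dvd by (intro mult_dvd_mono) auto
      then have "[poly (g a) h = poly (g a) 0] (mod P ^ k)"
        by (simp add: h cong_iff_dvd_diff)
      moreover have "(a + h) mod P = a" "a mod P = a"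
        using a h(1) by (auto simp: mod_simps elim!: dvdE)
      ultimately have "F (a + h) mod P ^ k = F a mod P ^ k"
        using F[of "a + h"] F[of a] by (simp add: cong_def)
      moreover have "a + h \<in> {0..P ^ k - 1}"
      proof -
        have "P \<le> h"
          using h by (simp add: zdvd_imp_le)
        moreover have "2 * h \<le> h * P"
          using p_gt_1 h(3) by (simp add: mult.commute)
        ultimately show ?thesis
          using a h unfolding atLeastAtMost_iff by linarith
      qed
      moreover have "a \<in> {0..P ^ k - 1}"
        using P_less a unfolding atLeastAtMost_iff by linarith
      ultimately have "a + h = a"
        using inj_onD[OF L, of "a + h" a] by simp
      then show False
        using h by simp
    qed
    from R0 R1 show "?R0 \<and> ?R1" ..
  next
    assume R: "?R0 \<and> ?R1"
    show ?L
    proof (rule inj_onI)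
      fix x y assume x: "x \<in> {0..P ^ k - 1}" and y: "y \<in> {0..P ^ k - 1}"
        and eq: "F x mod P ^ k = F y mod P ^ k"
      have "F x mod P = F y mod P"
        using eq Pk by (metis mod_mod_cancel)
      then have xy: "x mod P = y mod P"
        using inj_onD[OF conjunct1[OF R], of "x mod P" "y mod P"] p_gt_1 by (simp add: mod_P)
      define a where "a = x mod P"
      have a: "a \<in> {0..P - 1}"
        using p_gt_1 by (simp add: a_def)
      obtain r where r: "poly (g a) (x - a) - poly (g a) (y - a)
          = (x - a - (y - a)) * (coeff (g a) 1 + P * r)"
        using poly_diff_near_0[of P "x - a" "y - a"] xy by (metis a_def dvd_minus_mod)
      have "[poly (g a) (x - a) = poly (g a) (y - a)] (mod P ^ k)"
        using F[of x] F[of y] eq xy by (simp add: a_def cong_def)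
      then have "P ^ k dvd (x - y) * (coeff (g a) 1 + P * r)"
        using r by (simp add: cong_iff_dvd_diff)
      moreover have "\<not> P dvd coeff (g a) 1 + P * r"
        using R a by (simp add: dvd_add_left_iff)
      then have "coprime (P ^ k) (coeff (g a) 1 + P * r)"
        using prime_P by (simp add: prime_imp_coprime)
      ultimately have "P ^ k dvd x - y"
        by (simp add: coprime_dvd_mult_left_iff)
      then show "x = y"
        using x y by (simp flip: mod_eq_dvd_iff)
    qed
  qed
qed

section \<open>Normal forms for the local polynomials\<close>

text \<open>A pair \<open>v\<close> encodes the coefficients on one residue class: the constant one is
  \<open>r + p * fst v\<close> with \<open>r\<close> its residue modulo \<open>p\<close>, the higher ones are given by \<open>snd v\<close>.\<close>

definition local_poly :: "nat \<Rightarrow> nat \<times> (nat \<Rightarrow> nat) \<Rightarrow> int poly"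
  where "local_poly r v =
    [:int (r + p * fst v):] + (\<Sum>j=1..<k. monom (int (snd v j)) j)"

lemma coeff_local_poly:
  "coeff (local_poly r v) i =
    (if i = 0 then int (r + p * fst v) else if i < k then int (snd v i) else 0)"
  by (auto simp: local_poly_def coeff_sum coeff_pCons coeff_monom split: nat.splits)

lemma degree_local_poly: "degree (local_poly r v) < k"
  using k_ge_2 by (intro degree_lessI) (auto simp: coeff_local_poly)

text \<open>The residue modulo \<open>p\<close> of the constant term is left out because a
  permutation will supply it; its quotient by \<open>p\<close> has \<open>p ^ (k - 1)\<close>
  values. The linear coefficient has to be a unit, hence the totatives.\<close>

definition local_data :: "(nat \<times> (nat \<Rightarrow> nat)) set"
  where "local_data = {..<p ^ (k - 1)} \<times>
    (\<Pi>\<^sub>E j\<in>{1..<k}. if j = 1 then totatives (p ^ (k - 1)) else {..<p ^ (k - j)})"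

lemma p_power_gt_1: "p ^ (k - 1) > 1"
  using p_gt_1 k_ge_2 by (intro one_less_power) auto

lemma
  assumes "v \<in> local_data"
  shows fst_local_data_less: "fst v < p ^ (k - 1)"
    and snd_local_data_less: "j \<in> {1..<k} \<Longrightarrow> snd v j < p ^ (k - j)"
    and snd_local_data_1: "\<not> p dvd snd v 1"
proof -
  show "fst v < p ^ (k - 1)"
    using assms by (auto simp: local_data_def)
  have v: "snd v j \<in> (if j = 1 then totatives (p ^ (k - 1)) else {..<p ^ (k - j)})"
    if "j \<in> {1..<k}" for j
    using assms that unfolding local_data_def by (auto simp: PiE_iff split: if_splits)
  show "snd v j < p ^ (k - j)" if "j \<in> {1..<k}"
    \<comment> \<open>The strict bound for totatives needs a modulus above 1, since 1 is a totative
      of 1.\<close>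
    using v[OF that] totatives_less[OF _ p_power_gt_1] by (auto split: if_splits)
  have "coprime (snd v 1) (p ^ (k - 1))"
    using v[of 1] k_ge_2 by (simp add: in_totatives_iff)
  then have "coprime (snd v 1) p"
    using k_ge_2 by simp
  then show "\<not> p dvd snd v 1"
    using prime_p by (metis coprime_absorb_right not_prime_unit)
qed

lemma constant_term_less:
  assumes "r < p" "u < p ^ (k - 1)"
  shows "r + p * u < p ^ k"
proof -
  have "r + p * u < p * (u + 1)"
    using assms by simp
  also have "\<dots> \<le> p * p ^ (k - 1)"
    using assms by (intro mult_left_mono) auto
  also have "\<dots> = p ^ k"
    using k_ge_2 by (cases k) auto
  finally show ?thesis .
qed

text \<open>All coefficients lie below their moduli, so congruence forces equality; \<open>r\<close>
  and \<open>fst v\<close> are then recovered as remainder and quotient of the constant term by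
  \<open>p\<close>.\<close>

lemma local_poly_inject:
  assumes "r < p" "r' < p" "v \<in> local_data" "v' \<in> local_data"
    and dvd: "\<And>i. i < k \<Longrightarrow>
      P ^ (k - i) dvd coeff (local_poly r v) i - coeff (local_poly r' v') i"
  shows "r = r'" "v = v'"
proof -
  have "r + p * fst v = r' + p * fst v'"
    using dvd[of 0] k_ge_2 assms
    by (intro nat_eq_of_dvd_diff[of "p ^ k"] constant_term_less fst_local_data_less)
       (auto simp: coeff_local_poly)
  then have "(r + p * fst v) mod p = (r' + p * fst v') mod p"
    "(r + p * fst v) div p = (r' + p * fst v') div p"
    by simp_all
  then have r: "r = r'" and fst: "fst v = fst v'"
    using assms by simp_all
  have "snd v j = snd v' j" if "j \<in> {1..<k}" for j
    using dvd[of j] that assms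
    by (intro nat_eq_of_dvd_diff[of "p ^ (k - j)"] snd_local_data_less)
       (auto simp: coeff_local_poly)
  then have "snd v = snd v'"
    using assms(3,4) unfolding local_data_def mem_Times_iff by (blast intro: PiE_ext)
  with r fst show "r = r'" "v = v'"
    by (auto simp: prod_eq_iff)
qed

lemma local_poly_surj:
  fixes g :: "int poly"
  assumes "\<not> P dvd coeff g 1"
  shows "\<exists>v\<in>local_data. \<forall>i<k. P ^ (k - i) dvd
    coeff (local_poly (nat (coeff g 0 mod P)) v) i - coeff g i"
proof -
  \<comment> \<open>The data are the least residues of the coefficients for their respective moduli,
    with the constant one split by division by \<open>p\<close>.\<close>
  define c where "c i = nat (coeff g i mod P ^ (k - i))" for i
  define v where "v = (c 0 div p, restrict c {1..<k})"
  have c: "int (c i) = coeff g i mod P ^ (k - i)" for i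
    using p_gt_1 by (simp add: c_def)
  have c_less: "c i < p ^ (k - i)" for i
  proof -
    have "int (c i) < int (p ^ (k - i))"
      using p_gt_1 by (simp add: c)
    then show ?thesis by linarith
  qed
  have "c 0 < p * p ^ (k - 1)"
    using c_less[of 0] k_ge_2 by (cases k) auto
  then have "c 0 div p < p ^ (k - 1)"
    by (simp add: less_mult_imp_div_less mult.commute)
  moreover have "c 1 \<in> totatives (p ^ (k - 1))"
  proof -
    have "P dvd P ^ (k - 1)"
      using k_ge_2 by simp
    then have "\<not> P dvd int (c 1)"
      using assms by (simp add: c dvd_mod_iff)
    then have *: "\<not> p dvd c 1"
      by simp
    then have "coprime (c 1) (p ^ (k - 1))"
      using prime_imp_coprime[OF prime_p *] by (simp add: coprime_commute[of "c (Suc 0)"])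
    moreover have "c 1 > 0"
      using * by (intro Nat.gr0I) simp
    ultimately show ?thesis
      using c_less[of 1] by (simp add: in_totatives_iff)
  qed
  ultimately have "v \<in> local_data"
    using c_less by (auto simp: v_def local_data_def)
  moreover have "P ^ (k - i) dvd coeff (local_poly (nat (coeff g 0 mod P)) v) i - coeff g i"
    if "i < k" for i
  proof -
    have "nat (coeff g 0 mod P) = c 0 mod p"
    proof -
      have "int (c 0 mod p) = coeff g 0 mod P ^ k mod P"
        by (simp add: c zmod_int)
      also have "\<dots> = coeff g 0 mod P"
        using k_ge_2 by (simp add: mod_mod_cancel)
      finally show ?thesis by simp
    qed
    then have "coeff (local_poly (nat (coeff g 0 mod P)) v) i = int (c i)"
      using that by (auto simp: coeff_local_poly v_def)
    then show ?thesis
      by (simp add: c mod_eq_dvd_iff[symmetric])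
  qed
  ultimately show ?thesis by blast
qed

section \<open>Bijection between the data and the permutations\<close>

text \<open>The component \<open>s\<close> becomes the permutation that the function induces on
  residues modulo \<open>p\<close>.\<close>

definition glued_fun :: "(nat \<Rightarrow> nat) \<times> (nat \<Rightarrow> nat \<times> (nat \<Rightarrow> nat)) \<Rightarrow> int \<Rightarrow> int"
  where "glued_fun = (\<lambda>(s, v). \<lambda>x\<in>{0..P ^ k - 1}.
    poly (local_poly (s (nat (x mod P))) (v (nat (x mod P)))) (x - x mod P) mod P ^ k)"

definition glue_data :: "((nat \<Rightarrow> nat) \<times> (nat \<Rightarrow> nat \<times> (nat \<Rightarrow> nat))) set"
  where "glue_data = {s. s permutes {..<p}} \<times> ({..<p} \<rightarrow>\<^sub>E local_data)"

lemma glued_fun_in: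
  assumes "d \<in> glue_data"
  shows "glued_fun d \<in> Bij {0..P ^ k - 1} \<inter> range (residue_fun (P ^ k))"
proof -
  obtain s v where d: "d = (s, v)" by force
  have s: "s permutes {..<p}" and v: "\<And>a. a < p \<Longrightarrow> v a \<in> local_data"
    using assms by (auto simp: d glue_data_def)
  define g where "g a = local_poly (s (nat a)) (v (nat a))" for a :: int
  obtain f where f: "\<And>x. [poly f x = poly (g (x mod P)) (x - x mod P)] (mod P ^ k)"
    using glue_local_polys by blast
  have eq: "glued_fun d = residue_fun (P ^ k) f"
    using f by (auto simp: glued_fun_def d residue_fun_def g_def cong_def fun_eq_iff restrict_def)
  have "inj_on (\<lambda>a. coeff (g a) 0 mod P) {0..P - 1}"
  proof (rule inj_onI)
    fix a b assume ab: "a \<in> {0..P - 1}" "b \<in> {0..P - 1}"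
      and "coeff (g a) 0 mod P = coeff (g b) 0 mod P"
    moreover have "s (nat a) < p" "s (nat b) < p"
      using permutes_in_image[OF s] ab by (auto simp: nat_less_iff)
    ultimately have "s (nat a) = s (nat b)"
      by (simp add: g_def coeff_local_poly)
    then have "nat a = nat b"
      using permutes_inj[OF s] by (auto dest: injD)
    then show "a = b"
      using ab by (simp add: eq_nat_nat_iff)
  qed
  moreover have "\<not> P dvd coeff (g a) 1" if "a \<in> {0..P - 1}" for a
    using snd_local_data_1[of "v (nat a)"] v[of "nat a"] that k_ge_2
    by (auto simp: g_def coeff_local_poly nat_less_iff)
  ultimately have "inj_on (\<lambda>x. poly f x mod P ^ k) {0..P ^ k - 1}"
    using inj_on_residues_iff_local[OF f] by blast
  then have "bij_betw (\<lambda>x. poly f x mod P ^ k) {0..P ^ k - 1} {0..P ^ k - 1}"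
    using p_gt_1 endo_inj_surj[of "{0..P ^ k - 1}" "\<lambda>x. poly f x mod P ^ k"]
    by (simp add: bij_betw_def image_subset_iff)
  then show ?thesis
    by (auto simp: eq Bij_def residue_fun_def)
qed

lemma inj_on_glued_fun: "inj_on glued_fun glue_data"
proof (rule inj_onI)
  fix d d' assume d: "d \<in> glue_data" and d': "d' \<in> glue_data"
    and eq: "glued_fun d = glued_fun d'"
  obtain s v s' v' where sv: "d = (s, v)" "d' = (s', v')" by (metis surj_pair)
  have s: "s permutes {..<p}" "s' permutes {..<p}"
    and v: "v \<in> {..<p} \<rightarrow>\<^sub>E local_data" "v' \<in> {..<p} \<rightarrow>\<^sub>E local_data"
    using d d' by (auto simp: sv glue_data_def)
  have *: "s a = s' a \<and> v a = v' a" if a: "a < p" for a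
  proof -
    let ?G = "local_poly (s a) (v a)" and ?H = "local_poly (s' a) (v' a)"
    have "P ^ k dvd poly ?G (P * int t) - poly ?H (P * int t)" if t: "t < k" for t
    proof -
      \<comment> \<open>These \<open>k\<close> sample points of the class of \<open>a\<close> lie in
        the domain: \<open>t < k \<le> p\<close> and \<open>k \<ge> 2\<close> give
        \<open>a + p * t < p ^ 2 \<le> p ^ k\<close>.\<close>
      define x where "x = int a + P * int t"
      have "a + p * t < p ^ 2"
      proof -
        have "a + p * t < p * (t + 1)"
          using a by simp
        also have "\<dots> \<le> p * p"
          using t k_le_p by (intro mult_left_mono) auto
        finally show ?thesis by (simp add: power2_eq_square)
      qed
      also have "p ^ 2 \<le> p ^ k"
        using p_gt_1 k_ge_2 by (intro power_increasing) auto
      finally have "int (a + p * t) < int (p ^ k)"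
        by linarith
      then have "x \<in> {0..P ^ k - 1}"
        by (simp add: x_def)
      moreover have "x mod P = int a"
        using a by (simp add: x_def)
      ultimately show ?thesis
        using fun_cong[OF eq, of x]
        by (simp add: sv glued_fun_def mod_eq_dvd_iff) (simp add: x_def)
    qed
    then have "P ^ (k - i) dvd coeff ?G i - coeff ?H i" if "i < k" for i
      using that by (intro local_poly_coeff_cong degree_local_poly)
    moreover have "s a < p" "s' a < p"
      using permutes_in_image[OF s(1)] permutes_in_image[OF s(2)] a by auto
    moreover have "v a \<in> local_data" "v' a \<in> local_data"
      using v a by auto
    ultimately show ?thesis
      using local_poly_inject by blast
  qed
  have "s = s'"
    using * s by (metis ext lessThan_iff permutes_not_in)
  moreover have "v = v'"
    using * v by (auto intro: PiE_ext)
  ultimately show "d = d'"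
    by (simp add: sv)
qed

lemma glued_fun_surj:
  assumes "h \<in> Bij {0..P ^ k - 1} \<inter> range (residue_fun (P ^ k))"
  shows "h \<in> glued_fun ` glue_data"
proof -
  obtain f where h: "h = residue_fun (P ^ k) f" and inj: "inj_on h {0..P ^ k - 1}"
    using assms by (auto simp: Bij_def bij_betw_def)
  \<comment> \<open>This is the Taylor expansion of \<open>f\<close> at \<open>a\<close>, as a
    polynomial in the displacement from \<open>a\<close>.\<close>
  define g where "g a = pcompose f [:a, 1:]" for a
  have "inj_on (\<lambda>x. poly f x mod P ^ k) {0..P ^ k - 1}"
    using inj by (auto simp: h residue_fun_def inj_on_def)
  then have g0: "inj_on (\<lambda>a. coeff (g a) 0 mod P) {0..P - 1}"
    and g1: "\<And>a. a \<in> {0..P - 1} \<Longrightarrow> \<not> P dvd coeff (g a) 1"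
    using inj_on_residues_iff_local[of "poly f" g] by (auto simp: g_def poly_pcompose)
  \<comment> \<open>Outside \<open>{..<p}\<close> the identity is chosen, as \<open>permutes\<close>
    demands.\<close>
  define s where "s a = (if a < p then nat (coeff (g (int a)) 0 mod P) else a)" for a
  have "\<exists>v\<in>local_data. \<forall>i<k. P ^ (k - i) dvd
      coeff (local_poly (s a) v) i - coeff (g (int a)) i" if "a < p" for a
    using local_poly_surj[OF g1, of "int a"] that by (simp add: s_def)
  then obtain v where v: "\<And>a. a < p \<Longrightarrow> v a \<in> local_data"
    and dvd: "\<And>a i. a < p \<Longrightarrow> i < k \<Longrightarrow>
      P ^ (k - i) dvd coeff (local_poly (s a) (v a)) i - coeff (g (int a)) i"
    by metis
  have "inj_on s {..<p}"
  proof (rule inj_onI)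
    fix a b assume "a \<in> {..<p}" "b \<in> {..<p}" "s a = s b"
    then show "a = b"
      using inj_onD[OF g0, of "int a" "int b"] p_gt_1 by (simp add: s_def nat_eq_iff)
  qed
  moreover have "s ` {..<p} \<subseteq> {..<p}"
    using p_gt_1 by (auto simp: s_def nat_less_iff)
  ultimately have "s permutes {..<p}"
    using endo_inj_surj[of "{..<p}" s]
    by (intro bij_imp_permutes) (simp_all add: bij_betw_def, simp add: s_def)
  then have mem: "(s, restrict v {..<p}) \<in> glue_data"
    using v by (auto simp: glue_data_def)
  have "h x = glued_fun (s, restrict v {..<p}) x" for x
  proof (cases "x \<in> {0..P ^ k - 1}")
    case True
    define a where "a = nat (x mod P)"
    have a: "a < p" "int a = x mod P"
      using p_gt_1 by (auto simp: a_def nat_less_iff)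
    have "P ^ k dvd poly (local_poly (s a) (v a)) (x - int a) - poly (g (int a)) (x - int a)"
    proof (rule local_poly_value_cong[OF dvd[OF a(1)]])
      show "P dvd x - int a"
        unfolding a(2) by (rule dvd_minus_mod)
    qed
    then have "poly (local_poly (s a) (v a)) (x - int a) mod P ^ k = poly f x mod P ^ k"
      by (simp add: mod_eq_dvd_iff g_def poly_pcompose)
    then show ?thesis
      using True a by (simp add: h residue_fun_def glued_fun_def flip: a_def)
  next
    case False
    then show ?thesis
      by (simp only: h residue_fun_def glued_fun_def prod.case restrict_apply if_False)
  qed
  with mem show ?thesis by blast
qed

section \<open>Counting\<close>

lemma card_local_data:
  "card local_data = (p - 1) * p ^ ((k\<^sup>2 + k - 4) div 2)"
proof -
  \<comment> \<open>Writing \<open>k = n + 2\<close> removes truncated subtractions. The exponent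
    collects \<open>n + 1\<close> from the constant term, \<open>n\<close> from the totient, and
    \<open>1 + ... + n\<close> from the coefficients of degree at least 2.\<close>
  obtain n where k: "k = n + 2"
    using k_ge_2 by (metis le_add_diff_inverse2)
  have exponent: "n + 2 - 1 = n + 1"
    by simp
  have prod: "(\<Prod>j=2..<n + 2. p ^ (n + 2 - j)) = p ^ (\<Sum>i=1..n. i)"
  proof -
    have "(\<Prod>j=2..<n + 2. p ^ (n + 2 - j)) = (\<Prod>i=1..n. p ^ i)"
      by (rule prod.reindex_bij_witness[of _ "\<lambda>i. n + 2 - i" "\<lambda>j. n + 2 - j"]) auto
    then show ?thesis
      by (simp add: power_sum)
  qed
  have "card local_data = p ^ (n + 1) * (\<Prod>j=1..<n + 2.
      card (if j = 1 then totatives (p ^ (n + 1)) else {..<p ^ (n + 2 - j)}))"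
    unfolding local_data_def unfolding k
    by (simp only: card_cartesian_product card_PiE finite_atLeastLessThan card_lessThan exponent)
  also have "(\<Prod>j=1..<n + 2. card (if j = 1 then totatives (p ^ (n + 1)) else {..<p ^ (n + 2 - j)}))
      = totient (p ^ (n + 1)) * (\<Prod>j=2..<n + 2. p ^ (n + 2 - j))"
  proof -
    have "{1..<n + 2} = insert 1 {2..<n + 2}" by auto
    then show ?thesis by (simp add: totient_def)
  qed
  also have "p ^ (n + 1) * \<dots> = (p - 1) * p ^ ((n + 1) + n + (\<Sum>i=1..n. i))"
    unfolding prod using totient_prime_power[OF prime_p, of "n + 1"]
    by (simp add: power_add mult_ac)
  also have "(n + 1) + n + (\<Sum>i=1..n. i) = (k\<^sup>2 + k - 4) div 2"
  proof -
    have "2 * (\<Sum>i=1..n. i) = n * (n + 1)"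
      by (induction n) auto
    moreover have "k\<^sup>2 + k - 4 = n * (n + 1) + 2 * (2 * n + 1)"
      by (simp add: k power2_eq_square algebra_simps)
    ultimately show ?thesis by simp
  qed
  finally show ?thesis .
qed

lemma card_glue_data:
  "card glue_data = fact p * ((p - 1) * p ^ ((k\<^sup>2 + k - 4) div 2)) ^ p"
  by (simp add: glue_data_def card_cartesian_product card_permutations card_funcsetE
      card_local_data)

end

theorem theorem1p0p1:
  fixes p k :: nat
  assumes "prime p" and "k \<ge> 2" and "p \<ge> k"
  shows "order (Pgr (residue_ring (int (p ^ k)))) =
    fact p * ((p - 1) * p ^ ((k\<^sup>2 + k - 4) div 2)) ^ p"
proof -
  interpret large_prime_power p k
    using assms by unfold_locales
  interpret residues "int (p ^ k)" "residue_ring (int (p ^ k))"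
    using p_gt_1 k_ge_2 by unfold_locales (auto intro: one_less_power)
  have "bij_betw glued_fun glue_data (Bij {0..P ^ k - 1} \<inter> range (residue_fun (P ^ k)))"
    using inj_on_glued_fun glued_fun_in glued_fun_surj unfolding bij_betw_def by blast
  then have "card (carrier (Pgr (residue_ring (int (p ^ k))))) = card glue_data"
    using carrier_Pgr_residue_ring bij_betw_same_card by fastforce
  then show ?thesis
    by (simp add: Coset.order_def card_glue_data)
qed

end
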